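(* Let $\boldsymbol{m}=(m_1,\ldots,m_d)\in\mathbb{N}^d$ and let $a=(a_{s_1,\ldots,s_d}\in\mathbb{R} : s_j\in\{0,1,\ldots,m_j\},\ j=1,\ldots,d)$ be a real array. Consider the conditions: (C.1) $a_{s_1,\ldots,s_d}=0$ as soon as $s_j=0$ for some $j\in\{1,\ldots,d\}$; (C.2) $a_{m_1,\ldots,m_{j-1},s_j,m_{j+1},\ldots,m_d}=s_j/m_j$ for each $j\in\{1,\ldots,d\}$ and each $s_j\in\{0,1,\ldots,m_j\}$; (C.3) $\Delta_1\cdots\Delta_d\, a_{s_1,\ldots,s_d}\ge 0$ for all $(s_1,\ldots,s_d)\in\prod_{j=1}^d\{1,\ldots,m_j\}$. If (C.1), (C.2) and (C.3) hold, then the Bernstein polynomial $B_{\boldsymbol{m}}(a)$ is a copula. Moreover, (C.1) and (C.2) are necessary for $B_{\boldsymbol{m}}(a)$ to be a copula.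
   Context: $\mathbb{N}$ denotes the positive integers. For $m\in\mathbb{N}$, $s\in\{0,\ldots,m\}$ and $u\in[0,1]$, $p_{m,s}(u)=\binom{m}{s}u^s(1-u)^{m-s}$. The Bernstein polynomial of the array $a$ is $$B_{\boldsymbol{m}}(a)(\boldsymbol{u})=\sum_{s_1=0}^{m_1}\cdots\sum_{s_d=0}^{m_d}a_{s_1,\ldots,s_d}\prod_{j=1}^d p_{m_j,s_j}(u_j),\qquad \boldsymbol{u}=(u_1,\ldots,u_d)\in[0,1]^d.$$ The difference operators act by $\Delta_j a_{s_1,\ldots,s_d}=a_{s_1,\ldots,s_j,\ldots,s_d}-a_{s_1,\ldots,s_j-1,\ldots,s_d}$ (for $s_j\in\{1,\ldots,m_j\}$), so that $\Delta_1\cdots\Delta_d a_{s_1,\ldots,s_d}=\sum_{t\in\{0,1\}^d}(-1)^{\#\{j:t_j=1\}}a_{s_1-t_1,\ldots,s_d-t_d}$. A function $C:[0,1]^d\to[0,1]$ is a copula if and only if: (i) $C(\boldsymbol{u})=0$ whenever at least one $u_j$ equals $0$; (ii) $C(1,\ldots,1,u_j,1,\ldots,1)=u_j$ for all $j$ and all $u_j\in[0,1]$; (iii) $C$ is $d$-increasing: for all $\boldsymbol{u},\boldsymbol{v}\in[0,1]^d$ with $u_j<v_j$ for all $j$, $\sum_{\boldsymbol{w}}(-1)^{\#\{j:w_j=u_j\}}C(\boldsymbol{w})\ge0$, the sum being over all $\boldsymbol{w}$ with $w_j\in\{u_j,v_j\}$ for all $j$. *)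

theory Defs
  imports "HOL-Analysis.Analysis"
begin

text \<open>
  The coordinates \<open>1, \<dots>, d\<close> are the elements of a finite type \<open>'n\<close> with \<open>d = CARD('n)\<close>.  A
  multi-index is a function \<open>'n \<Rightarrow> nat\<close>, an array is a function on multi-indices of which only the
  values on the grid \<open>grid 0 m\<close> matter, and \<open>[0,1]\<^sup>d\<close> is the interval \<open>{0..1}\<close> in \<open>real ^ 'n\<close>
  (componentwise order).
\<close>

definition grid :: "nat \<Rightarrow> ('n::finite \<Rightarrow> nat) \<Rightarrow> ('n \<Rightarrow> nat) set"
  where "grid l m = (\<Pi>\<^sub>E j\<in>UNIV. {l..m j})"

definition bernstein_poly :: "('n::finite \<Rightarrow> nat) \<Rightarrow> (('n \<Rightarrow> nat) \<Rightarrow> real) \<Rightarrow> real ^ 'n \<Rightarrow> real"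
  where "bernstein_poly m a u = (\<Sum>s\<in>grid 0 m. a s * (\<Prod>j\<in>UNIV. Bernstein (m j) (s j) (u $ j)))"

text \<open>The backward difference in coordinate \<open>j\<close>; it is meaningful only where \<open>s j \<ge> 1\<close>.\<close>

definition diff_op :: "'n \<Rightarrow> (('n \<Rightarrow> nat) \<Rightarrow> real) \<Rightarrow> ('n \<Rightarrow> nat) \<Rightarrow> real"
  where "diff_op j a = (\<lambda>s. a s - a (s(j := s j - 1)))"

text \<open>
  The composition of all the \<open>diff_op j\<close>.  The operators commute, so the order in which the fold
  applies them is irrelevant; \<open>mixed_diff_eq_sum\<close> below is the resulting alternating sum.
\<close>

definition mixed_diff :: "(('n::finite \<Rightarrow> nat) \<Rightarrow> real) \<Rightarrow> ('n \<Rightarrow> nat) \<Rightarrow> real"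
  where "mixed_diff a = Finite_Set.fold diff_op a UNIV"

lemma diff_op_commute: "diff_op i (diff_op j a) = diff_op j (diff_op i a)"
  by (cases "i = j") (auto simp: diff_op_def fun_eq_iff fun_upd_twist)

interpretation diff_op: comp_fun_commute diff_op
  by standard (simp add: fun_eq_iff diff_op_commute)

lemma fold_diff_op_eq_sum:
  assumes "finite A"
  shows "Finite_Set.fold diff_op a A s =
    (\<Sum>T\<in>Pow A. (-1) ^ card T * a (\<lambda>j. s j - (if j \<in> T then 1 else 0)))"
  using assms
proof (induction A arbitrary: s rule: finite_induct)
  case empty
  then show ?case by simp
next
  case (insert x A)
  let ?h = "\<lambda>s T. (-1) ^ card T * a (\<lambda>j. s j - (if j \<in> T then 1 else 0))"
  have inj: "inj_on (insert x) (Pow A)"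
    using insert.hyps by (auto simp: inj_on_def)
  have disj: "Pow A \<inter> insert x ` Pow A = {}"
    using insert.hyps by auto
  have step: "?h s (insert x T) = - ?h (s(x := s x - 1)) T" if "T \<in> Pow A" for T
  proof -
    have T: "finite T" "x \<notin> T"
      using that insert.hyps finite_subset by auto
    have "(\<lambda>j. s j - (if j \<in> insert x T then 1 else 0)) =
        (\<lambda>j. (s(x := s x - 1)) j - (if j \<in> T then 1 else 0))"
      using T by (auto simp: fun_eq_iff)
    then show ?thesis
      using T by simp
  qed
  have "Finite_Set.fold diff_op a (insert x A) s = sum (?h s) (Pow A) - sum (?h (s(x := s x - 1))) (Pow A)"
  proof -
    have "Finite_Set.fold diff_op a (insert x A) s = diff_op x (Finite_Set.fold diff_op a A) s"
      using insert.hyps by simp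
    also have "\<dots> = Finite_Set.fold diff_op a A s - Finite_Set.fold diff_op a A (s(x := s x - 1))"
      by (simp only: diff_op_def)
    finally show ?thesis
      by (simp only: insert.IH)
  qed
  also have "\<dots> = sum (?h s) (Pow A) + (\<Sum>T\<in>Pow A. ?h s (insert x T))"
  proof -
    have "(\<Sum>T\<in>Pow A. ?h s (insert x T)) = (\<Sum>T\<in>Pow A. - ?h (s(x := s x - 1)) T)"
      by (rule sum.cong[OF refl step])
    then show ?thesis
      by (simp only: sum_negf diff_conv_add_uminus)
  qed
  also have "(\<Sum>T\<in>Pow A. ?h s (insert x T)) = sum (?h s) (insert x ` Pow A)"
    using sum.reindex[OF inj, of "?h s"] by (simp add: o_def)
  also have "sum (?h s) (Pow A) + \<dots> = sum (?h s) (Pow A \<union> insert x ` Pow A)"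
    using insert.hyps disj by (intro sum.union_disjoint[symmetric]) auto
  finally show ?case
    by (simp add: Pow_insert)
qed

lemma mixed_diff_eq_sum:
  fixes a :: "('n::finite \<Rightarrow> nat) \<Rightarrow> real"
  shows "mixed_diff a s =
    (\<Sum>t\<in>(\<Pi>\<^sub>E j\<in>UNIV. {0, 1}). (-1) ^ card {j. t j = 1} * a (\<lambda>j. s j - t j))"
proof -
  have "(\<Sum>T\<in>Pow UNIV. (-1) ^ card T * a (\<lambda>j. s j - (if j \<in> T then 1 else 0))) =
    (\<Sum>t\<in>(\<Pi>\<^sub>E j\<in>UNIV. {0, 1}). (-1) ^ card {j. t j = 1} * a (\<lambda>j. s j - t j))"
  proof (rule sum.reindex_bij_witness[where j = "\<lambda>T j. if j \<in> T then 1 else 0" and i = "\<lambda>t. {j. t j = 1}"])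
    fix t :: "'n \<Rightarrow> nat" assume "t \<in> (\<Pi>\<^sub>E j\<in>UNIV. {0, 1})"
    then have "t j = 0 \<or> t j = 1" for j by (auto simp: PiE_iff)
    then show "(\<lambda>j. if j \<in> {j. t j = 1} then 1 else 0) = t" by (auto simp: fun_eq_iff)
  qed (auto split: if_splits)
  then show ?thesis
    by (simp add: mixed_diff_def fold_diff_op_eq_sum)
qed

definition array_grounded :: "('n::finite \<Rightarrow> nat) \<Rightarrow> (('n \<Rightarrow> nat) \<Rightarrow> real) \<Rightarrow> bool"
  where "array_grounded m a \<longleftrightarrow> (\<forall>s\<in>grid 0 m. (\<exists>j. s j = 0) \<longrightarrow> a s = 0)"

definition array_uniform_margins :: "('n::finite \<Rightarrow> nat) \<Rightarrow> (('n \<Rightarrow> nat) \<Rightarrow> real) \<Rightarrow> bool"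
  where "array_uniform_margins m a \<longleftrightarrow> (\<forall>j. \<forall>k\<in>{0..m j}. a (m(j := k)) = real k / real (m j))"

definition array_increasing :: "('n::finite \<Rightarrow> nat) \<Rightarrow> (('n \<Rightarrow> nat) \<Rightarrow> real) \<Rightarrow> bool"
  where "array_increasing m a \<longleftrightarrow> (\<forall>s\<in>grid 1 m. mixed_diff a s \<ge> 0)"

text \<open>Only the restriction of \<open>C\<close> to the unit cube is constrained.\<close>

definition is_copula :: "(real ^ 'n \<Rightarrow> real) \<Rightarrow> bool"
  where "is_copula C \<longleftrightarrow>
    (\<forall>u\<in>{0..1}. C u \<in> {0..1}) \<and>
    (\<forall>u\<in>{0..1}. (\<exists>j. u $ j = 0) \<longrightarrow> C u = 0) \<and>
    (\<forall>j. \<forall>x\<in>{0..1}. C (\<chi> i. if i = j then x else 1) = x) \<and>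
    (\<forall>u\<in>{0..1}. \<forall>v\<in>{0..1}. (\<forall>j. u $ j < v $ j) \<longrightarrow>
      (\<Sum>w | \<forall>j. w $ j \<in> {u $ j, v $ j}. (-1) ^ card {j. w $ j = u $ j} * C w) \<ge> 0)"

end

theory Submission
  imports Defs "HOL-Computational_Algebra.Polynomial"
begin

text \<open>
  Summation by parts rewrites \<open>bernstein_poly m a u\<close>, for a grounded array, as the sum of
  \<open>mixed_diff a r\<close> times a product of binomial tail probabilities \<open>P(Bin(m\<^sub>j, u\<^sub>j) \<ge> r\<^sub>j)\<close>.  Each tail
  is a distribution function in \<open>u\<^sub>j\<close>, so nonnegative differences give a nonnegative combination of
  products of distribution functions, which is \<open>d\<close>-increasing.

  Conversely, the Bernstein coefficients are recovered from finitely many values of the polynomial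
  on the cube.  The functionals extracting the coefficients with \<open>s\<^sub>j = 0\<close> can be chosen to evaluate
  only at points with \<open>u\<^sub>j = 0\<close>, and the margins are a univariate problem.
\<close>

subsection \<open>Univariate Bernstein polynomials\<close>

lemma Bernstein_eq_0: "n < k \<Longrightarrow> Bernstein n k x = 0"
  by (simp add: Bernstein_def)

lemma Bernstein_at_0: "Bernstein n k 0 = (if k = 0 then 1 else 0)"
  by (simp add: Bernstein_def)

lemma Bernstein_at_1: "k \<le> n \<Longrightarrow> Bernstein n k 1 = (if k = n then 1 else 0)"
  by (simp add: Bernstein_def)

text \<open>Pascal's rule. For \<open>x\<close> in [0,1] it conditions \<open>n + 1\<close>
  Bernoulli trials on the outcome of the last one.\<close>

lemma Bernstein_Suc_Suc:
  "Bernstein (Suc n) (Suc k) x = (1 - x) * Bernstein n (Suc k) x + x * Bernstein n k x"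
proof (cases "Suc k \<le> n")
  case True
  then have "n - k = Suc (n - Suc k)" by simp
  then show ?thesis
    by (simp add: Bernstein_def algebra_simps)
next
  case False
  then show ?thesis
    by (cases "k = n") (auto simp: Bernstein_def binomial_eq_0)
qed

lemma sum_ratio_Bernstein:
  assumes "n \<ge> 1"
  shows "(\<Sum>k\<in>{0..n}. real k / real n * Bernstein n k x) = x"
proof -
  have "(\<Sum>k\<in>{0..n}. real k / real n * Bernstein n k x) = (\<Sum>k\<le>n. real k * Bernstein n k x) / real n"
    by (simp only: sum_divide_distrib atLeast0AtMost times_divide_eq_left)
  also have "\<dots> = x"
    using assms by (subst sum_k_Bernstein) simp
  finally show ?thesis .
qed

section \<open>Binomial tail probabilities\<close>

definition Bernstein_tail :: "nat \<Rightarrow> nat \<Rightarrow> real \<Rightarrow> real"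
  where "Bernstein_tail n r x = (\<Sum>k\<in>{r..n}. Bernstein n k x)"

lemma Bernstein_tail_0 [simp]: "Bernstein_tail n 0 x = 1"
  by (simp add: Bernstein_tail_def atLeast0AtMost)

lemma Bernstein_tail_at_0: "1 \<le> r \<Longrightarrow> Bernstein_tail n r 0 = 0"
  by (simp add: Bernstein_tail_def Bernstein_at_0)

lemma Bernstein_tail_nonneg: "x \<in> {0..1} \<Longrightarrow> 0 \<le> Bernstein_tail n r x"
  by (auto simp: Bernstein_tail_def intro!: sum_nonneg Bernstein_nonneg)

lemma Bernstein_tail_step:
  "r \<le> n \<Longrightarrow> Bernstein_tail n r x = Bernstein n r x + Bernstein_tail n (Suc r) x"
  by (simp add: Bernstein_tail_def sum.atLeast_Suc_atMost)

lemma Bernstein_tail_antimono: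
  assumes "x \<in> {0..1}" "r \<le> r'"
  shows "Bernstein_tail n r' x \<le> Bernstein_tail n r x"
  unfolding Bernstein_tail_def
  using assms by (intro sum_mono2) (auto intro: Bernstein_nonneg)

lemma Bernstein_tail_Suc_Suc:
  "Bernstein_tail (Suc n) (Suc r) x = (1 - x) * Bernstein_tail n (Suc r) x + x * Bernstein_tail n r x"
proof -
  have shift: "(\<Sum>k\<in>{Suc r..Suc n}. f k) = (\<Sum>k\<in>{r..n}. f (Suc k))" for f :: "nat \<Rightarrow> real"
    by (rule sum.shift_bounds_cl_Suc_ivl)
  have "(\<Sum>k\<in>{r..n}. Bernstein n (Suc k) x) = (\<Sum>k\<in>{Suc r..Suc n}. Bernstein n k x)"
    by (simp only: shift)
  also have "\<dots> = Bernstein_tail n (Suc r) x"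
    unfolding Bernstein_tail_def by (intro sum.mono_neutral_right) (auto simp: Bernstein_eq_0)
  finally have "(\<Sum>k\<in>{r..n}. Bernstein n (Suc k) x) = Bernstein_tail n (Suc r) x" .
  moreover have "Bernstein_tail (Suc n) (Suc r) x =
      (1 - x) * (\<Sum>k\<in>{r..n}. Bernstein n (Suc k) x) + x * (\<Sum>k\<in>{r..n}. Bernstein n k x)"
    unfolding Bernstein_tail_def shift Bernstein_Suc_Suc sum.distrib sum_distrib_left ..
  ultimately show ?thesis
    by (simp add: Bernstein_tail_def)
qed

text \<open>Induction on \<open>n\<close> takes the place of differentiation. The recursion makes
  the tail a mixture of \<open>?G\<close> and \<open>?H\<close> with weights \<open>1 - x\<close>
  and \<open>x\<close>. Both grow with their argument, and since \<open>?G <= ?H\<close>, shifting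
  weight from \<open>?G\<close> to \<open>?H\<close> increases the mixture as well.\<close>

lemma Bernstein_tail_mono:
  assumes "0 \<le> x" "x \<le> y" "y \<le> 1"
  shows "Bernstein_tail n r x \<le> Bernstein_tail n r y"
proof (induction n arbitrary: r)
  case 0
  show ?case
    by (simp add: Bernstein_tail_def Bernstein_def)
next
  case (Suc n)
  show ?case
  proof (cases r)
    case 0
    then show ?thesis by simp
  next
    case (Suc q)
    let ?G = "Bernstein_tail n (Suc q)" and ?H = "Bernstein_tail n q"
    have "(1 - x) * ?G x + x * ?H x \<le> (1 - x) * ?G y + x * ?H y"
      using assms Suc.IH by (intro add_mono mult_left_mono) auto
    also have "\<dots> = ?G y + x * (?H y - ?G y)"
      by (simp add: algebra_simps)
    also have "\<dots> \<le> ?G y + y * (?H y - ?G y)"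
      using assms Bernstein_tail_antimono[of y q "Suc q" n] by (intro add_left_mono mult_right_mono) auto
    also have "\<dots> = (1 - y) * ?G y + y * ?H y"
      by (simp add: algebra_simps)
    finally show ?thesis
      by (simp add: Suc Bernstein_tail_Suc_Suc)
  qed
qed

text \<open>Summation by parts in one coordinate: the bracket is the coefficient of
  \<open>a q\<close> in the backward difference \<open>a r - a (r - 1)\<close>, so the sum is the
  tail at \<open>q\<close> minus the tail at \<open>q + 1\<close>.\<close>

lemma sum_diff_Bernstein_tail:
  assumes "1 \<le> q" "q \<le> n"
  shows "(\<Sum>r\<in>{1..n}. (of_bool (r = q) - of_bool (r - 1 = q)) * Bernstein_tail n r x) = Bernstein n q x"
proof -
  have "(\<Sum>r\<in>{1..n}. of_bool (r = q) * Bernstein_tail n r x) = Bernstein_tail n q x"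
    using assms by (simp add: of_bool_def if_distrib[of "\<lambda>c. c * _"] cong: if_cong)
  moreover have "(\<Sum>r\<in>{1..n}. of_bool (r - 1 = q) * Bernstein_tail n r x) = Bernstein_tail n (Suc q) x"
  proof -
    have "(\<Sum>r\<in>{1..n}. of_bool (r - 1 = q) * Bernstein_tail n r x) =
        (\<Sum>r\<in>{1..n}. if r = Suc q then Bernstein_tail n r x else 0)"
      by (intro sum.cong) auto
    \<comment> \<open>For \<open>q = n\<close> the index \<open>Suc q\<close> lies outside the
      range, and the tail there is an empty sum; both sides are 0.\<close>
    also have "\<dots> = Bernstein_tail n (Suc q) x"
      by (auto simp: Bernstein_tail_def)
    finally show ?thesis .
  qed
  ultimately show ?thesis
    using assms by (simp add: left_diff_distrib sum_subtractf Bernstein_tail_step)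
qed

section \<open>Functionals that recover Bernstein coefficients from point values\<close>

lemma lagrange_monomial_dual:
  fixes n k :: nat
  shows "\<exists>w. \<forall>s\<le>n. (\<Sum>i\<le>n. w i * real i ^ s) = of_bool (s = k)"
proof -
  \<comment> \<open>The Lagrange basis for the nodes 0, ..., n. Interpolation at these nodes
    reproduces every monomial of degree at most \<open>n\<close>; comparing k-th coefficients in
    that identity shows that the k-th coefficient of \<open>L i\<close> is the required
    weight.\<close>
  define L :: "nat \<Rightarrow> real poly"
    where "L i = (\<Prod>l\<in>{..n} - {i}. smult (1 / (real i - real l)) [:- real l, 1:])" for i
  have L_eval: "poly (L i) (real r) = of_bool (i = r)" if "i \<le> n" "r \<le> n" for i r
  proof (cases "i = r")
    case True
    then show ?thesis
      by (auto simp: L_def poly_prod simp flip: diff_divide_distrib intro!: prod.neutral)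
  next
    case False
    then show ?thesis
      using that by (auto simp: L_def poly_prod intro!: bexI[of _ r])
  qed
  have L_degree: "degree (L i) \<le> n" if "i \<le> n" for i
  proof -
    have "degree (L i) \<le> (\<Sum>l\<in>{..n} - {i}. degree (smult (1 / (real i - real l)) [:- real l, 1:]))"
      unfolding L_def by (rule order.trans[OF degree_prod_sum_le]) (simp_all only: finite_Diff finite_atMost o_def order.refl)
    also have "\<dots> \<le> (\<Sum>l\<in>{..n} - {i}. 1)"
      by (intro sum_mono) simp
    also have "\<dots> = n"
      using that by simp
    finally show ?thesis .
  qed
  have "(\<Sum>i\<le>n. coeff (L i) k * real i ^ s) = of_bool (s = k)" if "s \<le> n" for s
  proof -
    have "(\<Sum>i\<le>n. smult (real i ^ s) (L i)) = monom 1 s"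
    proof (rule poly_eqI_degree)
      fix x assume "x \<in> real ` {..n}"
      then obtain r where r: "x = real r" "r \<le> n" by auto
      have "poly (\<Sum>i\<le>n. smult (real i ^ s) (L i)) x = (\<Sum>i\<le>n. if i = r then real i ^ s else 0)"
        unfolding poly_sum r(1) using r(2) by (intro sum.cong) (auto simp: L_eval)
      then show "poly (\<Sum>i\<le>n. smult (real i ^ s) (L i)) x = poly (monom 1 s) x"
        using r by (simp add: poly_monom)
    next
      have "degree (\<Sum>i\<le>n. smult (real i ^ s) (L i)) \<le> n"
        using L_degree by (intro degree_sum_le) (auto intro: order.trans[OF degree_smult_le])
      then show "degree (\<Sum>i\<le>n. smult (real i ^ s) (L i)) < card (real ` {..n})"
        by (simp add: card_image)
      show "degree (monom 1 s :: real poly) < card (real ` {..n})"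
        using that by (simp add: card_image degree_monom_eq)
    qed
    then have "coeff (\<Sum>i\<le>n. smult (real i ^ s) (L i)) k = coeff (monom 1 s) k"
      by simp
    then show ?thesis
      by (simp add: coeff_sum mult.commute)
  qed
  then show ?thesis by (intro exI[of _ "\<lambda>i. coeff (L i) k"]) simp
qed

text \<open>
  The substitution \<open>x = t / (1 + t)\<close> turns the Bernstein basis into monomials in \<open>t\<close>, up to the
  common factor \<open>(1 + t) ^ n\<close>.
\<close>

lemma Bernstein_dual:
  fixes n k :: nat
  assumes "k \<le> n"
  shows "\<exists>X w. (\<forall>i. X i \<in> {0..1}) \<and> (\<forall>s\<le>n. (\<Sum>i\<le>n. w i * Bernstein n s (X i)) = of_bool (s = k))"
proof -
  obtain v where v: "\<And>s. s \<le> n \<Longrightarrow> (\<Sum>i\<le>n. v i * real i ^ s) = of_bool (s = k)"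
    using lagrange_monomial_dual[of n k] by auto
  define X where "X i = real i / (1 + real i)" for i
  \<comment> \<open>The power cancels the common denominator of the Bernstein basis at
    \<open>X i\<close>, leaving \<open>v\<close> to be applied to monomials; the binomial
    coefficient normalises the value at \<open>s = k\<close> to 1.\<close>
  define w where "w i = v i * (1 + real i) ^ n / real (n choose k)" for i
  have B: "Bernstein n s (X i) * (1 + real i) ^ n = real (n choose s) * real i ^ s" if "s \<le> n" for s i
  proof -
    have "1 - X i = 1 / (1 + real i)"
      by (simp add: X_def field_simps)
    moreover have "(1 + real i) ^ n = (1 + real i) ^ s * (1 + real i) ^ (n - s)"
      using that by (simp flip: power_add)
    ultimately show ?thesis
      by (simp add: Bernstein_def X_def power_divide add_nonneg_eq_0_iff)
  qed
  show ?thesis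
  proof (intro exI conjI allI impI)
    show "X i \<in> {0..1}" for i
      by (simp add: X_def)
    show "(\<Sum>i\<le>n. w i * Bernstein n s (X i)) = of_bool (s = k)" if "s \<le> n" for s
    proof -
      have "(\<Sum>i\<le>n. w i * Bernstein n s (X i)) =
          (\<Sum>i\<le>n. v i * (Bernstein n s (X i) * (1 + real i) ^ n) / real (n choose k))"
        by (intro sum.cong) (simp_all add: w_def)
      also have "\<dots> = real (n choose s) / real (n choose k) * (\<Sum>i\<le>n. v i * real i ^ s)"
        unfolding B[OF that] sum_distrib_left by (intro sum.cong) simp_all
      also have "\<dots> = of_bool (s = k)"
        using assms by (simp add: v[OF that])
      finally show ?thesis .
    qed
  qed
qed

text \<open>The functional dual to the k-th basis polynomial evaluates only at points of [0,1], so
  agreement on that interval determines the k-th coefficient.\<close>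

lemma Bernstein_coeffs_unique:
  assumes "\<And>x. x \<in> {0..1} \<Longrightarrow>
      (\<Sum>k\<in>{0..n}. b k * Bernstein n k x) = (\<Sum>k\<in>{0..n}. c k * Bernstein n k x)"
    and "k \<le> n"
  shows "b k = c k"
proof -
  obtain X w where X: "\<forall>i. X i \<in> {0..1}"
    and dual: "\<forall>s\<le>n. (\<Sum>i\<le>n. w i * Bernstein n s (X i)) = of_bool (s = k)"
    using Bernstein_dual[OF assms(2)] by (elim exE conjE) (rule that)
  have recover: "(\<Sum>i\<le>n. w i * (\<Sum>s\<in>{0..n}. f s * Bernstein n s (X i))) = f k" for f
  proof -
    have "(\<Sum>i\<le>n. w i * (\<Sum>s\<in>{0..n}. f s * Bernstein n s (X i))) =
        (\<Sum>s\<in>{0..n}. f s * (\<Sum>i\<le>n. w i * Bernstein n s (X i)))"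
      unfolding sum_distrib_left by (subst sum.swap) (simp add: mult_ac)
    also have "\<dots> = (\<Sum>s\<in>{0..n}. if s = k then f s else 0)"
      by (intro sum.cong) (auto simp: dual)
    also have "\<dots> = f k"
      using assms(2) by simp
    finally show ?thesis .
  qed
  show ?thesis
    using recover[of b] recover[of c] assms(1)[OF X[rule_format]] by simp
qed

subsection \<open>Sums over grids\<close>

lemma finite_grid [simp]: "finite (grid l m)"
  by (simp add: grid_def finite_PiE)

lemma grid_iff: "s \<in> grid l m \<longleftrightarrow> (\<forall>j. l \<le> s j \<and> s j \<le> m j)"
  by (auto simp: grid_def PiE_iff)

lemma sum_grid_prod:
  fixes f :: "'n::finite \<Rightarrow> nat \<Rightarrow> real"
  shows "(\<Sum>s\<in>grid l m. \<Prod>j\<in>UNIV. f j (s j)) = (\<Prod>j\<in>UNIV. \<Sum>k\<in>{l..m j}. f j k)"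
  unfolding grid_def by (rule prod_sum_PiE[symmetric]) auto

lemma sum_vec_prod:
  fixes f :: "'n::finite \<Rightarrow> real \<Rightarrow> real"
  assumes "\<And>j. finite (K j)"
  shows "(\<Sum>w | \<forall>j. w $ j \<in> K j. \<Prod>j\<in>UNIV. f j (w $ j)) = (\<Prod>j\<in>UNIV. \<Sum>x\<in>K j. f j x)"
proof -
  have "(\<Prod>j\<in>UNIV. \<Sum>x\<in>K j. f j x) = (\<Sum>g\<in>PiE UNIV K. \<Prod>j\<in>UNIV. f j (g j))"
    using assms by (intro prod_sum_PiE) auto
  also have "\<dots> = (\<Sum>w | \<forall>j. w $ j \<in> K j. \<Prod>j\<in>UNIV. f j (w $ j))"
    by (rule sum.reindex_bij_witness[where i = vec_nth and j = vec_lambda]) (auto simp: PiE_iff)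
  finally show ?thesis ..
qed

text \<open>As a product over coordinates, the sign can be absorbed into the factors, so that
  alternating sums over a product set factor.\<close>

lemma minus_one_power_card:
  "(-1) ^ card {j. P j} = (\<Prod>j\<in>(UNIV :: 'n::finite set). if P j then -1 else (1::real))"
  by (simp add: prod.If_cases)

lemma prod_of_bool:
  "(\<Prod>j\<in>(UNIV :: 'n::finite set). of_bool (P j)) = (of_bool (\<forall>j. P j) :: real)"
  by (auto simp: intro!: prod.neutral bexI)

text \<open>The coefficient of each \<open>a q\<close> appears as a product over coordinates, which
  lets summation by parts be done one coordinate at a time.\<close>

lemma mixed_diff_eq_sum_grid:
  fixes a :: "('n::finite \<Rightarrow> nat) \<Rightarrow> real"
  assumes "r \<in> grid 1 m"
  shows "mixed_diff a r =
    (\<Sum>q\<in>grid 0 m. a q * (\<Prod>j\<in>UNIV. of_bool (r j = q j) - of_bool (r j - 1 = q j)))"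
proof -
  let ?T = "\<Pi>\<^sub>E j\<in>(UNIV :: 'n set). {0, 1 :: nat}"
  \<comment> \<open>Expanding each value over the whole grid by a product of indicators allows the
    sums over \<open>t\<close> and \<open>q\<close> to be swapped; the sum over \<open>t\<close>
    then factors.\<close>
  have expand: "a (\<lambda>j. r j - t j) =
      (\<Sum>q\<in>grid 0 m. a q * (\<Prod>j\<in>UNIV. of_bool (r j - t j = q j)))" for t
  proof -
    have "(\<lambda>j. r j - t j) \<in> grid 0 m"
      using assms by (auto simp: grid_iff intro: le_trans[OF diff_le_self])
    moreover have "(\<Sum>q\<in>grid 0 m. a q * (\<Prod>j\<in>UNIV. of_bool (r j - t j = q j))) =
        (\<Sum>q\<in>grid 0 m. if q = (\<lambda>j. r j - t j) then a q else 0)"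
      by (intro sum.cong) (auto simp: prod_of_bool fun_eq_iff)
    ultimately show ?thesis
      by simp
  qed
  have "mixed_diff a r = (\<Sum>t\<in>?T. (\<Prod>j\<in>UNIV. if t j = 1 then -1 else 1) *
      (\<Sum>q\<in>grid 0 m. a q * (\<Prod>j\<in>UNIV. of_bool (r j - t j = q j))))"
    unfolding mixed_diff_eq_sum minus_one_power_card expand ..
  also have "\<dots> = (\<Sum>q\<in>grid 0 m. a q * (\<Sum>t\<in>?T.
      \<Prod>j\<in>UNIV. (if t j = 1 then -1 else 1) * of_bool (r j - t j = q j)))"
    unfolding sum_distrib_left prod.distrib by (subst sum.swap) (simp only: mult_ac)
  also have "\<dots> = (\<Sum>q\<in>grid 0 m. a q *
      (\<Prod>j\<in>UNIV. \<Sum>t\<in>{0, 1}. (if t = 1 then -1 else 1) * of_bool (r j - t = q j)))"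
    by (subst prod_sum_PiE) simp_all
  also have "\<dots> = (\<Sum>q\<in>grid 0 m. a q * (\<Prod>j\<in>UNIV. of_bool (r j = q j) - of_bool (r j - 1 = q j)))"
  proof -
    have "(\<Sum>t\<in>{0, 1}. (if t = 1 then -1 else 1) * of_bool (r j - t = q j)) =
        (of_bool (r j = q j) - of_bool (r j - 1 = q j) :: real)" for q j
      by (subst sum.insert) auto
    then show ?thesis by simp
  qed
  finally show ?thesis .
qed

text \<open>Once the sums over \<open>r\<close> and \<open>q\<close> are swapped, the sum over
  \<open>r\<close> factors and each factor telescopes to a Bernstein basis polynomial.\<close>

lemma bernstein_poly_eq_tail_sum:
  fixes a :: "('n::finite \<Rightarrow> nat) \<Rightarrow> real"
  assumes "array_grounded m a"
  shows "bernstein_poly m a u =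
    (\<Sum>r\<in>grid 1 m. mixed_diff a r * (\<Prod>j\<in>UNIV. Bernstein_tail (m j) (r j) (u $ j)))"
proof -
  let ?D = "\<lambda>r q. of_bool (r = q) - of_bool (r - 1 = q) :: real"
  have "(\<Sum>r\<in>grid 1 m. mixed_diff a r * (\<Prod>j\<in>UNIV. Bernstein_tail (m j) (r j) (u $ j))) =
      (\<Sum>r\<in>grid 1 m. (\<Sum>q\<in>grid 0 m. a q * (\<Prod>j\<in>UNIV. ?D (r j) (q j))) *
        (\<Prod>j\<in>UNIV. Bernstein_tail (m j) (r j) (u $ j)))"
    by (intro sum.cong refl) (simp only: mixed_diff_eq_sum_grid)
  also have "\<dots> = (\<Sum>q\<in>grid 0 m. a q *
      (\<Sum>r\<in>grid 1 m. \<Prod>j\<in>UNIV. ?D (r j) (q j) * Bernstein_tail (m j) (r j) (u $ j)))"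
    unfolding sum_distrib_left sum_distrib_right prod.distrib
    by (subst sum.swap) (simp only: mult_ac)
  also have "\<dots> = (\<Sum>q\<in>grid 0 m. a q *
      (\<Prod>j\<in>UNIV. \<Sum>r\<in>{1..m j}. ?D r (q j) * Bernstein_tail (m j) r (u $ j)))"
    by (intro sum.cong arg_cong[where f = "(*) _"] refl
        sum_grid_prod[where f = "\<lambda>j r. ?D r (_ j) * Bernstein_tail (m j) r (u $ j)"])
  also have "\<dots> = bernstein_poly m a u"
    unfolding bernstein_poly_def
  proof (rule sum.cong[OF refl])
    fix q assume q: "q \<in> grid 0 m"
    show "a q * (\<Prod>j\<in>UNIV. \<Sum>r\<in>{1..m j}. ?D r (q j) * Bernstein_tail (m j) r (u $ j)) =
        a q * (\<Prod>j\<in>UNIV. Bernstein (m j) (q j) (u $ j))"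
    \<comment> \<open>Telescoping requires \<open>q j >= 1\<close> in every coordinate; groundedness
      disposes of every other \<open>q\<close>.\<close>
    proof (cases "\<exists>j. q j = 0")
      case True
      then have "a q = 0"
        using assms q by (simp add: array_grounded_def)
      then show ?thesis by simp
    next
      case False
      then have "1 \<le> q j \<and> q j \<le> m j" for j
        using q by (simp add: grid_iff Suc_le_eq)
      then show ?thesis
        by (simp only: sum_diff_Bernstein_tail)
    qed
  qed
  finally show ?thesis ..
qed

text \<open>At argument 1 only the top basis polynomial is nonzero, so exactly the multi-indices
  \<open>m(j := k)\<close> can contribute.\<close>

lemma bernstein_poly_margin:
  fixes a :: "('n::finite \<Rightarrow> nat) \<Rightarrow> real"
  shows "bernstein_poly m a (\<chi> i. if i = j then x else 1) =
    (\<Sum>k\<in>{0..m j}. a (m(j := k)) * Bernstein (m j) k x)"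
proof -
  let ?u = "\<chi> i. if i = j then x else 1"
  let ?S = "(\<lambda>k. m(j := k)) ` {0..m j}"
  have inj: "inj_on (\<lambda>k. m(j := k)) {0..m j}"
    by (rule inj_onI) (metis fun_upd_same)
  have prod: "(\<Prod>i\<in>UNIV. Bernstein (m i) (s i) (?u $ i)) =
      Bernstein (m j) (s j) x * (\<Prod>i\<in>UNIV - {j}. Bernstein (m i) (s i) 1)" for s
    by (subst prod.remove[of _ j]) auto
  have "bernstein_poly m a ?u = (\<Sum>s\<in>?S. a s * (\<Prod>i\<in>UNIV. Bernstein (m i) (s i) (?u $ i)))"
    unfolding bernstein_poly_def
  proof (rule sum.mono_neutral_right)
    show "?S \<subseteq> grid 0 m"
      by (auto simp: grid_iff)
    show "\<forall>s\<in>grid 0 m - ?S. a s * (\<Prod>i\<in>UNIV. Bernstein (m i) (s i) (?u $ i)) = 0"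
    proof
      fix s assume s: "s \<in> grid 0 m - ?S"
      have "\<exists>i. i \<noteq> j \<and> s i \<noteq> m i"
      proof (rule ccontr)
        assume "\<not> ?thesis"
        then have "s = m(j := s j)" by (auto simp: fun_eq_iff)
        then show False using s by (auto simp: grid_iff)
      qed
      then obtain i where i: "i \<noteq> j" "s i \<noteq> m i" by blast
      moreover have "s i \<le> m i"
        using s by (simp add: grid_iff)
      ultimately have "\<exists>i\<in>UNIV - {j}. Bernstein (m i) (s i) 1 = 0"
        by (intro bexI[of _ i]) (auto simp: Bernstein_at_1)
      then have "(\<Prod>i\<in>UNIV - {j}. Bernstein (m i) (s i) 1) = 0"
        by (intro prod_zero) auto
      then show "a s * (\<Prod>i\<in>UNIV. Bernstein (m i) (s i) (?u $ i)) = 0"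
        by (simp only: prod)
    qed
  qed simp
  also have "\<dots> = (\<Sum>k\<in>{0..m j}. a (m(j := k)) *
      (\<Prod>i\<in>UNIV. Bernstein (m i) ((m(j := k)) i) (?u $ i)))"
    by (simp only: sum.reindex[OF inj] o_def)
  also have "\<dots> = (\<Sum>k\<in>{0..m j}. a (m(j := k)) * Bernstein (m j) k x)"
    unfolding prod by (simp add: Bernstein_at_1)
  finally show ?thesis .
qed

subsection \<open>Copulas among Bernstein polynomials\<close>

lemma bernstein_poly_increasing:
  fixes a :: "('n::finite \<Rightarrow> nat) \<Rightarrow> real"
  assumes "array_grounded m a" "array_increasing m a"
    and uv: "u \<in> {0..1}" "v \<in> {0..1}" "\<And>j. u $ j < v $ j"
  shows "(\<Sum>w | \<forall>j. w $ j \<in> {u $ j, v $ j}.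
    (-1) ^ card {j. w $ j = u $ j} * bernstein_poly m a w) \<ge> 0"
proof -
  let ?W = "{w. \<forall>j. w $ j \<in> {u $ j, v $ j}}"
  let ?f = "\<lambda>r j x. (if x = u $ j then -1 else 1) * Bernstein_tail (m j) (r j) x"
  have u: "0 \<le> u $ j" and v: "v $ j \<le> 1" for j
    using uv by (simp_all add: less_eq_vec_def)
  \<comment> \<open>Signs and tails are both products over coordinates, so for each \<open>r\<close>
    the alternating sum over the vertices of the box becomes a product of tail increments.\<close>
  have "(\<Sum>w\<in>?W. (-1) ^ card {j. w $ j = u $ j} * bernstein_poly m a w) =
      (\<Sum>w\<in>?W. \<Sum>r\<in>grid 1 m. mixed_diff a r * (\<Prod>j\<in>UNIV. ?f r j (w $ j)))"
    unfolding bernstein_poly_eq_tail_sum[OF assms(1)] minus_one_power_card sum_distrib_left prod.distrib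
    by (simp only: mult_ac)
  also have "\<dots> = (\<Sum>r\<in>grid 1 m. mixed_diff a r * (\<Sum>w\<in>?W. \<Prod>j\<in>UNIV. ?f r j (w $ j)))"
    by (subst sum.swap) (simp only: sum_distrib_left)
  also have "\<dots> = (\<Sum>r\<in>grid 1 m. mixed_diff a r * (\<Prod>j\<in>UNIV. \<Sum>x\<in>{u $ j, v $ j}. ?f r j x))"
    by (intro sum.cong arg_cong[where f = "(*) _"] refl
        sum_vec_prod[where K = "\<lambda>j. {u $ j, v $ j}" and f = "?f _"]) simp
  also have "\<dots> = (\<Sum>r\<in>grid 1 m. mixed_diff a r *
      (\<Prod>j\<in>UNIV. Bernstein_tail (m j) (r j) (v $ j) - Bernstein_tail (m j) (r j) (u $ j)))"
  proof -
    \<comment> \<open>Strict inequality makes the two endpoints distinct: \<open>u $ j\<close>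
      contributes with sign -1 and \<open>v $ j\<close> with sign +1.\<close>
    have "(\<Sum>x\<in>{u $ j, v $ j}. ?f r j x) =
        Bernstein_tail (m j) (r j) (v $ j) - Bernstein_tail (m j) (r j) (u $ j)" for r j
      using uv(3)[of j] by (subst sum.insert) auto
    then show ?thesis by simp
  qed
  also have "\<dots> \<ge> 0"
    using assms(2) u v less_imp_le[OF uv(3)]
    by (intro sum_nonneg mult_nonneg_nonneg prod_nonneg)
      (auto simp: array_increasing_def intro!: Bernstein_tail_mono)
  finally show ?thesis .
qed

lemma is_copula_bernstein_poly:
  fixes a :: "('n::finite \<Rightarrow> nat) \<Rightarrow> real"
  assumes m: "\<And>j. m j \<ge> 1"
    and a: "array_grounded m a" "array_uniform_margins m a" "array_increasing m a"
  shows "is_copula (bernstein_poly m a)"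
proof -
  note tail = bernstein_poly_eq_tail_sum[OF a(1)]
  have diff_nonneg: "mixed_diff a r \<ge> 0" if "r \<in> grid 1 m" for r
    using a(3) that by (simp add: array_increasing_def)
  have margin: "bernstein_poly m a (\<chi> i. if i = j then x else 1) = x" for j x
    using a(2) sum_ratio_Bernstein[OF m, of j x]
    by (simp add: bernstein_poly_margin array_uniform_margins_def)
  have range: "bernstein_poly m a u \<in> {0..1}" if "u \<in> {0..1}" for u
  proof -
    have u: "0 \<le> u $ j" "u $ j \<le> 1" for j
      using that by (simp_all add: less_eq_vec_def)
    have "0 \<le> bernstein_poly m a u"
      unfolding tail using u
      by (intro sum_nonneg mult_nonneg_nonneg prod_nonneg diff_nonneg)
        (auto intro!: Bernstein_tail_nonneg)
    \<comment> \<open>Every tail is nondecreasing, so the maximum over the cube is attained at the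
      all-ones vertex, where the margin condition gives the value 1.\<close>
    moreover have "bernstein_poly m a u \<le> bernstein_poly m a (\<chi> i. 1)"
      unfolding tail using u
      by (intro sum_mono mult_left_mono prod_mono diff_nonneg)
        (auto intro!: Bernstein_tail_nonneg Bernstein_tail_mono)
    moreover have "bernstein_poly m a (\<chi> i. 1) = 1"
      using margin[of _ 1] by simp
    ultimately show ?thesis by simp
  qed
  have grounded: "bernstein_poly m a u = 0" if "u $ j = 0" for u j
    unfolding tail
  proof (rule sum.neutral, rule ballI)
    fix r assume "r \<in> grid 1 m"
    then have "Bernstein_tail (m j) (r j) (u $ j) = 0"
      using that by (simp add: grid_iff Bernstein_tail_at_0)
    then have "(\<Prod>j\<in>UNIV. Bernstein_tail (m j) (r j) (u $ j)) = 0"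
      by (intro prod_zero) auto
    then show "mixed_diff a r * (\<Prod>j\<in>UNIV. Bernstein_tail (m j) (r j) (u $ j)) = 0"
      by simp
  qed
  show ?thesis
    unfolding is_copula_def
    using range grounded margin bernstein_poly_increasing[OF a(1,3)] by blast
qed

section \<open>Necessity of groundedness and uniform margins\<close>

text \<open>
  Tensor products of the univariate dual functionals; the choice \<open>X j i = 0\<close> in the coordinate \<open>j\<close>
  with \<open>s j = 0\<close> keeps all evaluation points on the face \<open>u $ j = 0\<close>.
\<close>

lemma bernstein_poly_dual:
  fixes a :: "('n::finite \<Rightarrow> nat) \<Rightarrow> real"
  assumes "s \<in> grid 0 m"
    and dual: "\<And>j k. k \<le> m j \<Longrightarrow> (\<Sum>i\<in>{0..m j}. w j i * Bernstein (m j) k (X j i)) = of_bool (k = s j)"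
  shows "(\<Sum>g\<in>grid 0 m. (\<Prod>j\<in>UNIV. w j (g j)) * bernstein_poly m a (\<chi> j. X j (g j))) = a s"
proof -
  have "(\<Sum>g\<in>grid 0 m. (\<Prod>j\<in>UNIV. w j (g j)) * bernstein_poly m a (\<chi> j. X j (g j))) =
      (\<Sum>q\<in>grid 0 m. a q * (\<Sum>g\<in>grid 0 m. \<Prod>j\<in>UNIV. w j (g j) * Bernstein (m j) (q j) (X j (g j))))"
    unfolding bernstein_poly_def sum_distrib_left prod.distrib vec_lambda_beta
    by (subst sum.swap) (simp only: mult_ac)
  also have "\<dots> = (\<Sum>q\<in>grid 0 m. a q *
      (\<Prod>j\<in>UNIV. \<Sum>i\<in>{0..m j}. w j i * Bernstein (m j) (q j) (X j i)))"
    by (intro sum.cong arg_cong[where f = "(*) _"] refl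
        sum_grid_prod[where f = "\<lambda>j i. w j i * Bernstein (m j) (_ j) (X j i)"])
  also have "\<dots> = (\<Sum>q\<in>grid 0 m. if q = s then a q else 0)"
    by (intro sum.cong) (auto simp: grid_iff dual prod_of_bool fun_eq_iff)
  also have "\<dots> = a s"
    using assms(1) by simp
  finally show ?thesis .
qed

lemma is_copula_imp_array_grounded:
  fixes a :: "('n::finite \<Rightarrow> nat) \<Rightarrow> real"
  assumes "is_copula (bernstein_poly m a)"
  shows "array_grounded m a"
  unfolding array_grounded_def
proof (intro ballI impI)
  fix s assume s: "s \<in> grid 0 m" and "\<exists>j. s j = 0"
  then obtain j where j: "s j = 0" by blast
  have "\<exists>X w. (\<forall>i. X i \<in> {0..1}) \<and> (l = j \<longrightarrow> (\<forall>i. X i = 0)) \<and>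
      (\<forall>k\<le>m l. (\<Sum>i\<in>{0..m l}. w i * Bernstein (m l) k (X i)) = of_bool (k = s l))" for l
  proof (cases "l = j")
    case True
    \<comment> \<open>Evaluation at 0 reads off the coefficient of index 0, since all other basis
      polynomials vanish there. All points \<open>X i\<close> coincide in this coordinate, so the
      weight is put on \<open>i = 0\<close> alone.\<close>
    have "(\<Sum>i\<in>{0..m l}. of_bool (i = 0) * Bernstein (m l) k 0) = of_bool (k = s l)" for k
      using j True by (simp add: Bernstein_at_0 of_bool_def if_distrib[of "\<lambda>c. c * _"] cong: if_cong)
    then show ?thesis
      by (intro exI[of _ "\<lambda>_. 0"] exI[of _ "\<lambda>i. of_bool (i = 0)"]) auto
  next
    case False
    have "s l \<le> m l"
      using s by (simp add: grid_iff)
    from Bernstein_dual[OF this] show ?thesis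
      using False by (simp add: atLeast0AtMost)
  qed
  then obtain X w where X: "\<And>l i. X l i \<in> {0..1}" "\<And>i. X j i = 0"
    and dual: "\<And>l k. k \<le> m l \<Longrightarrow>
      (\<Sum>i\<in>{0..m l}. w l i * Bernstein (m l) k (X l i)) = of_bool (k = s l)"
    by metis
  have "bernstein_poly m a (\<chi> l. X l (g l)) = 0" for g
  proof -
    have "(\<chi> l. X l (g l)) \<in> {0..1}"
      using X(1) by (simp add: less_eq_vec_def)
    moreover have "\<exists>l. (\<chi> l. X l (g l)) $ l = 0"
      using X(2) by (intro exI[of _ j]) simp
    ultimately show ?thesis
      using assms unfolding is_copula_def by blast
  qed
  then show "a s = 0"
    using bernstein_poly_dual[where a = a, OF s dual] by simp
qed

text \<open>The j-th margin is a univariate Bernstein polynomial with coefficients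
  \<open>a (m(j := k))\<close>. For a copula it is the identity on [0,1], whose Bernstein
  coefficients are \<open>k / m j\<close>; uniqueness of coefficients concludes.\<close>

lemma is_copula_imp_array_uniform_margins:
  fixes a :: "('n::finite \<Rightarrow> nat) \<Rightarrow> real"
  assumes m: "\<And>j. m j \<ge> 1" and "is_copula (bernstein_poly m a)"
  shows "array_uniform_margins m a"
  unfolding array_uniform_margins_def
proof (intro allI ballI)
  fix j k assume k: "k \<in> {0..m j}"
  have "(\<Sum>k\<in>{0..m j}. a (m(j := k)) * Bernstein (m j) k x) =
      (\<Sum>k\<in>{0..m j}. real k / real (m j) * Bernstein (m j) k x)" if "x \<in> {0..1}" for x
    using assms(2) that unfolding sum_ratio_Bernstein[OF m] bernstein_poly_margin[symmetric] is_copula_def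
    by blast
  then show "a (m(j := k)) = real k / real (m j)"
    by (rule Bernstein_coeffs_unique) (use k in auto)
qed

theorem proposition2p3:
  fixes m :: "'n::finite \<Rightarrow> nat" and a :: "('n \<Rightarrow> nat) \<Rightarrow> real"
  assumes "\<forall>j. m j \<ge> 1"
  shows "(array_grounded m a \<and> array_uniform_margins m a \<and> array_increasing m a
            \<longrightarrow> is_copula (bernstein_poly m a)) \<and>
         (is_copula (bernstein_poly m a) \<longrightarrow> array_grounded m a \<and> array_uniform_margins m a)"
  using assms is_copula_bernstein_poly is_copula_imp_array_grounded
    is_copula_imp_array_uniform_margins by blast

end
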